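(* Suppose $D$ is an oriented graph which does not contain any of $F_1, F_2, G_1, G_2$ as an induced subgraph. Then $$\chi_A(D) \leq \left\lfloor \frac{1}{3} \cdot \Delta(D) + \frac{5}{3} \right\rfloor.$$
   Context: Digraphs are finite, nonempty, without loops and without parallel edges in the same direction. An oriented graph is a digraph in which at most one edge connects any pair of vertices (so there are no directed 2-cycles). $\Delta(D)$ is the maximum total degree (in-degree plus out-degree) of a vertex of $D$. An acyclic set in a digraph is a set of vertices whose induced subgraph contains no directed cycle. $\chi_A(D)$, the digraph chromatic number, is the minimum number of acyclic sets into which $V(D)$ can be partitioned. $F_1, F_2, G_1, G_2$ are the following digraphs on the four vertices $q, r, w, y$: $F_1$ has edges $q\to r$, $q\to w$, $r\to y$, $w\to y$; $F_2$ has the edges of $F_1$ together with $w\to r$; $G_1$ has the edges of $F_1$ together with $y\to q$; $G_2$ has the edges of $F_1$ together with $w\to r$ and $y\to q$. Containing a digraph as an induced subgraph means having an induced subgraph isomorphic to it. *)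

theory Defs
  imports Complex_Main "Graph_Theory.Graph_Theory" "HOL-Library.Disjoint_Sets"
begin

text \<open>The library locale \<^locale>\<open>digraph\<close> is finite, loop-free and without parallel arcs in the
  same direction; it admits the null graph, which is excluded here. Taking \<open>e1\<close> and \<open>e2\<close> to be
  opposite arcs shows that directed 2-cycles are forbidden.\<close>

locale oriented_graph = digraph +
  assumes verts_nonempty: "verts G \<noteq> {}"
    and at_most_one_arc: "\<And>e1 e2. \<lbrakk>e1 \<in> arcs G; e2 \<in> arcs G;
      {tail G e1, head G e1} = {tail G e2, head G e2}\<rbrakk> \<Longrightarrow> e1 = e2"

definition max_degree :: "('a,'b) pre_digraph \<Rightarrow> nat" where
  "max_degree D = Max ((\<lambda>v. in_degree D v + out_degree D v) ` verts D)"

definition acyclic_set :: "('a,'b) pre_digraph \<Rightarrow> 'a set \<Rightarrow> bool" where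
  "acyclic_set D S \<longleftrightarrow> S \<subseteq> verts D \<and> (\<nexists>c. pre_digraph.cycle (D \<restriction> S) c)"

text \<open>\<^const>\<open>partition_on\<close> requires nonempty parts, which does not affect the minimum.\<close>

definition dichromatic_number :: "('a,'b) pre_digraph \<Rightarrow> nat" where
  "dichromatic_number D =
    (LEAST k. \<exists>P. partition_on (verts D) P \<and> finite P \<and> card P = k \<and> (\<forall>S\<in>P. acyclic_set D S))"

definition contains_induced :: "('a,'b) pre_digraph \<Rightarrow> ('c,'d) pre_digraph \<Rightarrow> bool" where
  "contains_induced D F \<longleftrightarrow> (\<exists>H. induced_subgraph H D \<and> digraph_iso H F)"

datatype vertex4 = Q | R | W | Y

definition F1 :: "vertex4 pair_pre_digraph" where
  "F1 = \<lparr> pverts = {Q, R, W, Y}, parcs = {(Q,R), (Q,W), (R,Y), (W,Y)} \<rparr>"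

definition F2 :: "vertex4 pair_pre_digraph" where
  "F2 = \<lparr> pverts = {Q, R, W, Y}, parcs = {(Q,R), (Q,W), (R,Y), (W,Y), (W,R)} \<rparr>"

definition G1 :: "vertex4 pair_pre_digraph" where
  "G1 = \<lparr> pverts = {Q, R, W, Y}, parcs = {(Q,R), (Q,W), (R,Y), (W,Y), (Y,Q)} \<rparr>"

definition G2 :: "vertex4 pair_pre_digraph" where
  "G2 = \<lparr> pverts = {Q, R, W, Y}, parcs = {(Q,R), (Q,W), (R,Y), (W,Y), (W,R), (Y,Q)} \<rparr>"

end

theory Submission
  imports Defs
begin

text \<open>
  The four forbidden digraphs are exactly the ways in which two different paths
  \<open>q \<rightarrow> r \<rightarrow> y\<close> and \<open>q \<rightarrow> w \<rightarrow> y\<close> can be completed without an arc \<open>q \<rightarrow> y\<close>: the pair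
  \<open>r, w\<close> is adjacent or not, and the arc \<open>y \<rightarrow> q\<close> is present or not. So forbidding them says that two
  different directed paths of length two with the same ends \<open>q, y\<close> force the arc \<open>q \<rightarrow> y\<close>
  (\<open>arc_between_ends_of_two_paths\<close>).

  Let \<open>K = \<lfloor>(\<Delta> + 5) / 3\<rfloor>\<close>, and colour the vertices with \<open>K\<close> colours so that the number of
  monochromatic arcs is least and, subject to that, the number of monochromatic directed cycles
  is least. Moving a vertex to another colour cannot decrease the number of monochromatic arcs, so a
  vertex has at most as many neighbours in its own colour as in any other. All degrees are less than
  \<open>3 K\<close>, hence this number is at most two, and a monochromatic directed cycle has no further
  neighbours in its colour. A vertex \<open>u\<close> of such a cycle \<open>C\<close> has two neighbours of its own colour;
  since its degree is at most \<open>3 K - 2\<close>, some other colour \<open>j\<close> also occurs exactly twice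
  (\<open>exchange_colour\<close>). Recolouring \<open>u\<close> with \<open>j\<close> keeps the number of monochromatic arcs and destroys
  \<open>C\<close>, so by minimality it creates a directed cycle through \<open>u\<close>, and the new colouring is optimal
  again (\<open>exchange\<close>). What remains of \<open>C\<close> is a directed path from the out-neighbour \<open>a\<close> of \<open>u\<close> to
  its in-neighbour \<open>b\<close> (\<open>leftover_circuit\<close>).

  Repeat this, each time moving a vertex of the current cycle other than the one just moved. No
  vertex is moved twice as long as the cycles avoid the paths left over earlier. And they always do:
  if moving \<open>u'\<close> closed up a leftover path from \<open>a\<close> to \<open>b\<close> that an earlier vertex \<open>u \<noteq> u'\<close> had
  left, then \<open>b \<rightarrow> u \<rightarrow> a\<close> and \<open>b \<rightarrow> u' \<rightarrow> a\<close> would force the arc \<open>b \<rightarrow> a\<close>, although \<open>a\<close> has no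
  in-neighbour on the path (\<open>leftover_not_rejoined\<close>). Thus the leftover paths occupy more and more
  vertices, which is impossible in a finite digraph (\<open>no_chain\<close>): an optimal colouring has no
  monochromatic directed cycle.
\<close>

section \<open>Circuits in finite oriented relations\<close>

locale finite_orientation =
  fixes V :: "'a set" and A :: "'a \<Rightarrow> 'a \<Rightarrow> bool"
  assumes finite_V: "finite V"
    and arc_in_V: "A x y \<Longrightarrow> x \<in> V \<and> y \<in> V"
    and asym: "A x y \<Longrightarrow> \<not> A y x"
begin

definition adj :: "'a \<Rightarrow> 'a \<Rightarrow> bool" where
  "adj x y \<longleftrightarrow> A x y \<or> A y x"

definition nbrs :: "('a \<Rightarrow> nat) \<Rightarrow> 'a \<Rightarrow> nat \<Rightarrow> 'a set" where
  "nbrs c u i = {y. adj u y \<and> c y = i}"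

definition mono_arcs :: "('a \<Rightarrow> nat) \<Rightarrow> ('a \<times> 'a) set" where
  "mono_arcs c = {(x, y). A x y \<and> c x = c y}"

text \<open>
  A finite set of vertices contains a directed cycle iff it has a subset of this kind, which makes
  it possible to argue about cycles without walks.
\<close>

definition fed :: "'a set \<Rightarrow> bool" where
  "fed T \<longleftrightarrow> T \<noteq> {} \<and> (\<forall>x\<in>T. \<exists>y\<in>T. A y x)"

text \<open>
  The minimal fed sets are the vertex sets of induced directed cycles.
\<close>

definition circuit :: "'a set \<Rightarrow> bool" where
  "circuit T \<longleftrightarrow> fed T \<and> (\<forall>S. S \<subset> T \<longrightarrow> \<not> fed S)"

definition mono_circuits :: "('a \<Rightarrow> nat) \<Rightarrow> 'a set set" where
  "mono_circuits c = {T. circuit T \<and> (\<forall>x\<in>T. \<forall>y\<in>T. c x = c y)}"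

lemma mono_circuits_circuit: "T \<in> mono_circuits c \<Longrightarrow> circuit T"
  unfolding mono_circuits_def by blast

lemma mono_circuits_colour: "T \<in> mono_circuits c \<Longrightarrow> x \<in> T \<Longrightarrow> y \<in> T \<Longrightarrow> c x = c y"
  unfolding mono_circuits_def by blast

lemma irrefl: "\<not> A x x"
  using asym by blast

lemma fed_subset_V: "fed T \<Longrightarrow> T \<subseteq> V"
  unfolding fed_def using arc_in_V by blast

lemma circuit_subset_V: "circuit T \<Longrightarrow> T \<subseteq> V"
  unfolding circuit_def using fed_subset_V by blast

lemma finite_nbrs: "finite (nbrs c u i)"
  by (rule finite_subset[OF _ finite_V]) (auto simp: nbrs_def adj_def dest: arc_in_V)

lemma finite_mono_arcs: "finite (mono_arcs c)"
  by (rule finite_subset[of _ "V \<times> V"])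
    (auto simp: mono_arcs_def finite_V dest: arc_in_V)

lemma finite_mono_circuits: "finite (mono_circuits c)"
  by (rule finite_subset[of _ "Pow V"])
    (auto simp: mono_circuits_def finite_V dest: circuit_subset_V)

lemma fed_contains_circuit:
  assumes "fed T"
  shows "\<exists>S\<subseteq>T. circuit S"
proof -
  have "finite T"
    using fed_subset_V[OF assms] finite_V finite_subset by blast
  then show ?thesis
    using assms
  proof (induction T rule: finite_psubset_induct)
    case (psubset T)
    show ?case
    proof (cases "circuit T")
      case False
      then obtain S where "S \<subset> T" "fed S"
        using psubset.prems unfolding circuit_def by blast
      then show ?thesis
        using psubset.IH[of S] by blast
    qed blast
  qed
qed

text \<open>
  Following out-arcs also finds a directed cycle. In terms of sets: a vertex without an
  in-neighbour in \<open>S\<close> is not the chosen out-neighbour of any vertex of \<open>S\<close>, so it can be deleted.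
\<close>

lemma successor_closed_contains_fed:
  assumes "finite S" "S \<noteq> {}" "\<And>x. x \<in> S \<Longrightarrow> \<exists>y\<in>S. A x y"
  shows "\<exists>T\<subseteq>S. fed T"
  using assms
proof (induction S rule: finite_psubset_induct)
  case (psubset S)
  show ?case
  proof (cases "fed S")
    case False
    then obtain x where x: "x \<in> S" "\<And>y. y \<in> S \<Longrightarrow> \<not> A y x"
      using psubset.prems(1) unfolding fed_def by blast
    obtain y where "y \<in> S" "A x y"
      using psubset.prems(2) x(1) by blast
    then have "S - {x} \<noteq> {}"
      using irrefl by blast
    moreover have "\<And>z. z \<in> S - {x} \<Longrightarrow> \<exists>y\<in>S - {x}. A z y"
      using psubset.prems(2) x(2) by (metis Diff_iff singletonD)
    ultimately show ?thesis
      using psubset.IH[of "S - {x}"] x(1) by blast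
  qed blast
qed

lemma circuit_predecessor: "circuit T \<Longrightarrow> x \<in> T \<Longrightarrow> \<exists>y\<in>T. A y x"
  unfolding circuit_def fed_def by blast

text \<open>
  A vertex without an out-neighbour in \<open>T\<close> feeds no other vertex, so deleting it would leave a
  smaller fed set.
\<close>

lemma circuit_successor:
  assumes "circuit T" "x \<in> T"
  shows "\<exists>y\<in>T. A x y"
proof (rule ccontr)
  assume none: "\<not> ?thesis"
  obtain y where "y \<in> T" "A y x"
    using circuit_predecessor[OF assms] by blast
  then have "T - {x} \<noteq> {}"
    using irrefl by blast
  moreover have "\<exists>y\<in>T - {x}. A y z" if "z \<in> T - {x}" for z
    using circuit_predecessor[OF assms(1), of z] that none by blast
  ultimately have "fed (T - {x})"
    unfolding fed_def by blast
  then show False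
    using assms unfolding circuit_def by blast
qed

text \<open>
  As there are no opposite arcs, the monochromatic arcs at \<open>u\<close> correspond one to one to the
  neighbours of \<open>u\<close> in its own colour.
\<close>

lemma card_mono_arcs_split:
  "card (mono_arcs c) = card {(x, y) \<in> mono_arcs c. x \<noteq> u \<and> y \<noteq> u} + card (nbrs c u (c u))"
proof -
  let ?R = "{(x, y) \<in> mono_arcs c. x \<noteq> u \<and> y \<noteq> u}"
  let ?f = "\<lambda>y. if A u y then (u, y) else (y, u)"
  have inj: "inj_on ?f (nbrs c u (c u))"
    by (auto simp: inj_on_def)
  have split: "mono_arcs c = ?R \<union> ?f ` nbrs c u (c u)"
  proof (intro equalityI subsetI)
    fix e assume e: "e \<in> mono_arcs c"
    obtain x y where xy: "e = (x, y)"
      by fastforce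
    show "e \<in> ?R \<union> ?f ` nbrs c u (c u)"
    proof (cases "x = u \<or> y = u")
      case True
      then consider "x = u" | "y = u"
        by blast
      then show ?thesis
      proof cases
        case 1
        then have "y \<in> nbrs c u (c u)" "e = ?f y"
          using e xy by (auto simp: mono_arcs_def nbrs_def adj_def)
        then show ?thesis
          by blast
      next
        case 2
        then have "x \<in> nbrs c u (c u)" "e = ?f x"
          using e xy asym by (auto simp: mono_arcs_def nbrs_def adj_def)
        then show ?thesis
          by blast
      qed
    qed (use e xy in auto)
  qed (auto simp: mono_arcs_def nbrs_def adj_def)
  have disj: "?R \<inter> ?f ` nbrs c u (c u) = {}"
    by auto
  have "finite ?R"
    by (rule finite_subset[OF _ finite_mono_arcs[of c]]) auto
  then have "card (?R \<union> ?f ` nbrs c u (c u)) = card ?R + card (?f ` nbrs c u (c u))"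
    by (intro card_Un_disjoint finite_imageI finite_nbrs disj)
  then show ?thesis
    unfolding split[symmetric] card_image[OF inj] .
qed

lemma nbrs_recolour: "nbrs (c(u := j)) u i = nbrs c u i"
  unfolding nbrs_def adj_def using irrefl by auto

text \<open>
  Written as a sum on both sides because subtraction of natural numbers truncates.
\<close>

lemma card_mono_arcs_recolour:
  "card (mono_arcs (c(u := j))) + card (nbrs c u (c u)) = card (mono_arcs c) + card (nbrs c u j)"
proof -
  have "{(x, y) \<in> mono_arcs (c(u := j)). x \<noteq> u \<and> y \<noteq> u} = {(x, y) \<in> mono_arcs c. x \<noteq> u \<and> y \<noteq> u}"
    by (auto simp: mono_arcs_def)
  then show ?thesis
    using card_mono_arcs_split[of c u] card_mono_arcs_split[of "c(u := j)" u]
    by (simp add: nbrs_recolour)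
qed

end

section \<open>Optimal colourings\<close>

locale sparse_orientation = finite_orientation +
  fixes K :: nat
  assumes degree_bound: "u \<in> V \<Longrightarrow> card {y. adj u y} + 2 \<le> 3 * K"
    and two_path_closed: "\<lbrakk>A b u; A u a; A b w; A w a; u \<noteq> w\<rbrakk> \<Longrightarrow> A b a"
begin

definition colouring :: "('a \<Rightarrow> nat) \<Rightarrow> bool" where
  "colouring c \<longleftrightarrow> (\<forall>x\<in>V. c x < K)"

text \<open>
  Two stages, because the structure of a colour class depends on the first minimality alone. It can
  therefore be used for a recoloured map before that map is known to be optimal.
\<close>

definition arc_minimal :: "('a \<Rightarrow> nat) \<Rightarrow> bool" where
  "arc_minimal c \<longleftrightarrow> colouring c \<and>
     (\<forall>c'. colouring c' \<longrightarrow> card (mono_arcs c) \<le> card (mono_arcs c'))"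

definition optimal :: "('a \<Rightarrow> nat) \<Rightarrow> bool" where
  "optimal c \<longleftrightarrow> arc_minimal c \<and>
     (\<forall>c'. arc_minimal c' \<longrightarrow> card (mono_circuits c) \<le> card (mono_circuits c'))"

lemma optimal_exists: "\<exists>c. optimal c"
proof -
  have "colouring (\<lambda>_. 0)"
    using degree_bound unfolding colouring_def by fastforce
  then obtain c0 where "arc_minimal c0"
    using ex_has_least_nat[of colouring _ "\<lambda>c. card (mono_arcs c)"]
    unfolding arc_minimal_def by blast
  then show ?thesis
    using ex_has_least_nat[of arc_minimal _ "\<lambda>c. card (mono_circuits c)"]
    unfolding optimal_def by blast
qed

lemma arc_minimal_colour: "arc_minimal c \<Longrightarrow> x \<in> V \<Longrightarrow> c x < K"
  unfolding arc_minimal_def colouring_def by blast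

lemma colouring_recolour: "arc_minimal c \<Longrightarrow> j < K \<Longrightarrow> colouring (c(u := j))"
  unfolding arc_minimal_def colouring_def by simp

lemma own_colour_least:
  assumes "arc_minimal c" "j < K"
  shows "card (nbrs c u (c u)) \<le> card (nbrs c u j)"
proof -
  have "card (mono_arcs c) \<le> card (mono_arcs (c(u := j)))"
    using assms colouring_recolour[OF assms] unfolding arc_minimal_def by blast
  then show ?thesis
    using card_mono_arcs_recolour[of c u j] by linarith
qed

lemma sum_nbrs:
  assumes "arc_minimal c"
  shows "(\<Sum>i<K. card (nbrs c u i)) = card {y. adj u y}"
proof -
  have "c y < K" if "adj u y" for y
    using that arc_in_V arc_minimal_colour[OF assms] unfolding adj_def by blast
  then have "{y. adj u y} = (\<Union>i<K. nbrs c u i)"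
    unfolding nbrs_def by blast
  moreover have "nbrs c u i \<inter> nbrs c u j = {}" if "i \<noteq> j" for i j
    using that unfolding nbrs_def by blast
  then have "card (\<Union>i<K. nbrs c u i) = (\<Sum>i<K. card (nbrs c u i))"
    by (intro card_UN_disjoint) (simp_all add: finite_nbrs)
  ultimately show ?thesis
    by simp
qed

text \<open>
  With three neighbours in every colour, the degree would be at least \<open>3 K\<close>.
\<close>

lemma own_colour_le_2:
  assumes "arc_minimal c" "u \<in> V"
  shows "card (nbrs c u (c u)) \<le> 2"
proof (rule ccontr)
  assume many: "\<not> ?thesis"
  have "3 \<le> card (nbrs c u i)" if "i < K" for i
    using many own_colour_least[OF assms(1) that, of u] by linarith
  then have "(\<Sum>i<K. 3) \<le> (\<Sum>i<K. card (nbrs c u i))"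
    by (intro sum_mono) auto
  then show False
    using sum_nbrs[OF assms(1)] degree_bound[OF assms(2)] by simp
qed

text \<open>
  The in-neighbour and the out-neighbour on the circuit already exhaust the two neighbours that
  \<open>x\<close> may have in its own colour.
\<close>

lemma circuit_nbrs:
  assumes "arc_minimal c" "T \<in> mono_circuits c" "x \<in> T"
  obtains p s where "p \<in> T" "s \<in> T" "A p x" "A x s" "p \<noteq> s" "nbrs c x (c x) = {p, s}"
proof -
  note T = mono_circuits_circuit[OF assms(2)] mono_circuits_colour[OF assms(2) _ assms(3)]
  obtain p s where ps: "p \<in> T" "s \<in> T" "A p x" "A x s"
    using circuit_predecessor circuit_successor T(1) assms(3) by meson
  have "p \<noteq> s"
    using ps asym by blast
  have sub: "{p, s} \<subseteq> nbrs c x (c x)"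
    using ps T(2) by (auto simp: nbrs_def adj_def)
  have "x \<in> V"
    using ps arc_in_V by blast
  moreover have "card {p, s} = 2"
    using \<open>p \<noteq> s\<close> by simp
  ultimately have "card (nbrs c x (c x)) \<le> card {p, s}"
    using own_colour_le_2[OF assms(1)] by metis
  then have "nbrs c x (c x) = {p, s}"
    using card_seteq[OF finite_nbrs sub] by simp
  then show thesis
    using that ps \<open>p \<noteq> s\<close> by blast
qed

lemma circuit_own_colour:
  assumes "arc_minimal c" "T \<in> mono_circuits c" "x \<in> T"
  shows "card (nbrs c x (c x)) = 2"
proof -
  obtain p s where "p \<noteq> s" "nbrs c x (c x) = {p, s}"
    using circuit_nbrs[OF assms] .
  then show ?thesis
    by simp
qed

lemma circuit_closed:
  assumes "arc_minimal c" "T \<in> mono_circuits c" "x \<in> T" "adj x y" "c y = c x"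
  shows "y \<in> T"
proof -
  obtain p s where "p \<in> T" "s \<in> T" "nbrs c x (c x) = {p, s}"
    using circuit_nbrs[OF assms(1-3)] .
  moreover have "y \<in> nbrs c x (c x)"
    using assms(4,5) by (simp add: nbrs_def)
  ultimately show ?thesis
    by auto
qed

text \<open>
  Each circuit contains all neighbours of its vertices in its colour, so the intersection of two
  circuits that meet is fed, and minimality makes it equal to both.
\<close>

lemma mono_circuits_eq:
  assumes "arc_minimal c" "S \<in> mono_circuits c" "T \<in> mono_circuits c" "u \<in> S" "u \<in> T"
  shows "S = T"
proof -
  have col: "c x = c u" if "x \<in> S \<union> T" for x
    using assms that mono_circuits_colour by blast
  note circ = mono_circuits_circuit[OF assms(2)] mono_circuits_circuit[OF assms(3)]
  have "\<exists>y\<in>S \<inter> T. A y x" if x: "x \<in> S \<inter> T" for x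
  proof -
    obtain y where "y \<in> S" "A y x"
      using circuit_predecessor circ(1) x by blast
    then show ?thesis
      using circuit_closed[OF assms(1,3), of x y] col[of x] col[of y] x by (auto simp: adj_def)
  qed
  then have "fed (S \<inter> T)"
    using assms unfolding fed_def by blast
  then have "S \<inter> T = S" "S \<inter> T = T"
    using circ unfolding circuit_def by (meson psubsetI Int_lower1 Int_lower2)+
  then show ?thesis
    by metis
qed

text \<open>
  Otherwise \<open>u\<close> would have two neighbours in its own colour and three in each of the other
  \<open>K - 1\<close> colours, hence degree at least \<open>3 K - 1\<close>.
\<close>

lemma exchange_colour:
  assumes "arc_minimal c" "T \<in> mono_circuits c" "u \<in> T"
  obtains j where "j < K" "j \<noteq> c u" "card (nbrs c u j) = 2"
proof -
  have uV: "u \<in> V"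
    using circuit_subset_V[OF mono_circuits_circuit[OF assms(2)]] assms(3) by blast
  have own: "card (nbrs c u (c u)) = 2"
    using circuit_own_colour[OF assms] .
  have "\<exists>j<K. j \<noteq> c u \<and> card (nbrs c u j) \<le> 2"
  proof (rule ccontr)
    assume many: "\<not> ?thesis"
    have "3 \<le> card (nbrs c u i)" if "i \<in> {..<K} - {c u}" for i
    proof -
      have "\<not> card (nbrs c u i) \<le> 2"
        using many that by blast
      then show ?thesis
        by linarith
    qed
    then have "(\<Sum>i\<in>{..<K} - {c u}. 3 :: nat) \<le> (\<Sum>i\<in>{..<K} - {c u}. card (nbrs c u i))"
      by (intro sum_mono) auto
    moreover have "c u < K"
      using arc_minimal_colour[OF assms(1) uV] .
    moreover have "(\<Sum>i<K. card (nbrs c u i)) = card (nbrs c u (c u)) + (\<Sum>i\<in>{..<K} - {c u}. card (nbrs c u i))"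
      using \<open>c u < K\<close> by (intro sum.remove) auto
    moreover have "(\<Sum>i\<in>{..<K} - {c u}. 3 :: nat) = 3 * (K - 1)"
      using \<open>c u < K\<close> by simp
    ultimately show False
      using sum_nbrs[OF assms(1), of u] degree_bound[OF uV] own by linarith
  qed
  then obtain j where "j < K" "j \<noteq> c u" "card (nbrs c u j) \<le> 2"
    by blast
  then show thesis
    using that[of j] own_colour_least[OF assms(1), of j u] own by linarith
qed

text \<open>
  The number of monochromatic arcs does not change, and a circuit of the new colouring that avoids
  \<open>u\<close> was a circuit of the old one different from \<open>C\<close>. As the number of circuits cannot drop, a new
  circuit through \<open>u\<close> must replace \<open>C\<close>; as only one circuit passes through \<open>u\<close>, the number
  cannot grow either.
\<close>

lemma exchange:
  assumes "optimal c" "C \<in> mono_circuits c" "u \<in> C"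
    and "j < K" "card (nbrs c u j) = 2"
  shows "optimal (c(u := j))" and "\<exists>C'\<in>mono_circuits (c(u := j)). u \<in> C'"
proof -
  let ?c = "c(u := j)"
  let ?N = "{T \<in> mono_circuits ?c. u \<in> T}"
  have min: "arc_minimal c"
    using assms(1) unfolding optimal_def by blast
  have "card (nbrs c u (c u)) = 2"
    using circuit_own_colour[OF min assms(2,3)] .
  then have "card (mono_arcs ?c) = card (mono_arcs c)"
    using card_mono_arcs_recolour[of c u j] assms(5) by linarith
  then have min': "arc_minimal ?c"
    using min colouring_recolour[OF min assms(4)] unfolding arc_minimal_def by simp
  have old: "T \<in> mono_circuits c - {C}" if T: "T \<in> mono_circuits ?c" "u \<notin> T" for T
  proof -
    have "c x = c y" if "x \<in> T" "y \<in> T" for x y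
      using mono_circuits_colour[OF T(1) that] that T(2) by (metis fun_upd_other)
    then show ?thesis
      using mono_circuits_circuit[OF T(1)] T(2) assms(3) unfolding mono_circuits_def by blast
  qed
  have less: "card (mono_circuits c - {C}) < card (mono_circuits c)"
    using assms(2) finite_mono_circuits by (meson card_Diff1_less)
  show ex: "\<exists>C'\<in>mono_circuits ?c. u \<in> C'"
  proof (rule ccontr)
    assume "\<not> ?thesis"
    then have "mono_circuits ?c \<subseteq> mono_circuits c - {C}"
      using old by blast
    then have "card (mono_circuits ?c) \<le> card (mono_circuits c - {C})"
      by (intro card_mono) (auto simp: finite_mono_circuits)
    then show False
      using assms(1) min' less unfolding optimal_def by fastforce
  qed
  then obtain C' where C': "C' \<in> mono_circuits ?c" "u \<in> C'"
    by blast
  have "mono_circuits ?c \<subseteq> insert C' (mono_circuits c - {C})"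
    using old mono_circuits_eq[OF min' _ C'(1) _ C'(2)] by blast
  then have "card (mono_circuits ?c) \<le> card (insert C' (mono_circuits c - {C}))"
    by (intro card_mono) (auto simp: finite_mono_circuits)
  also have "\<dots> \<le> card (mono_circuits c)"
    using less card_insert_if[of "mono_circuits c - {C}" C'] finite_mono_circuits[of c]
    by auto
  finally show "optimal ?c"
    using assms(1) min' unfolding optimal_def by (meson le_trans)
qed

section \<open>Chains of exchanges\<close>

text \<open>
  These are the properties of an induced directed path with first vertex \<open>a\<close> and last vertex \<open>b\<close>
  that matter for closing it up to a circuit.
\<close>

definition path_between :: "'a set \<Rightarrow> 'a \<Rightarrow> 'a \<Rightarrow> bool" where
  "path_between L a b \<longleftrightarrow> a \<in> L \<and> b \<in> L \<and> (\<forall>y\<in>L. \<not> A y a \<and> \<not> A b y) \<and>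
     (\<forall>x\<in>L - {a}. \<exists>y\<in>L. A y x) \<and> (\<forall>x\<in>L - {b}. \<exists>y\<in>L. A x y)"

text \<open>
  \<open>L\<close> is a path that forms a union of connected components of its colour class, and the arcs from
  its last vertex to \<open>w\<close> and from \<open>w\<close> to its first vertex once made it a circuit.
\<close>

definition leftover :: "('a \<Rightarrow> nat) \<Rightarrow> 'a set \<Rightarrow> 'a \<Rightarrow> bool" where
  "leftover c L w \<longleftrightarrow> (\<exists>a b. path_between L a b \<and> A b w \<and> A w a) \<and>
     (\<exists>i. \<forall>x\<in>L. c x = i \<and> nbrs c x i \<subseteq> L)"

lemma leftover_circuit:
  assumes "arc_minimal c" "C \<in> mono_circuits c" "u \<in> C" "j \<noteq> c u"
  shows "leftover (c(u := j)) (C - {u}) u"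
proof -
  obtain b a where ab: "b \<in> C" "a \<in> C" "A b u" "A u a" "b \<noteq> a"
    and N: "nbrs c u (c u) = {b, a}"
    using circuit_nbrs[OF assms(1-3)] .
  note circ = mono_circuits_circuit[OF assms(2)]
    and col = mono_circuits_colour[OF assms(2) _ assms(3)]
  have "a \<noteq> u" "b \<noteq> u"
    using ab irrefl by blast+
  have in_a: "\<not> A y a" if "y \<in> C - {u}" for y
  proof
    assume "A y a"
    obtain p s where ps: "A a s" "nbrs c a (c a) = {p, s}"
      using circuit_nbrs[OF assms(1,2) ab(2)] .
    have "u \<in> nbrs c a (c a)" "y \<in> nbrs c a (c a)"
      using that \<open>A y a\<close> ab(2,4) col unfolding nbrs_def adj_def by auto
    moreover have "u \<noteq> s" "y \<noteq> s"
      using ps(1) \<open>A y a\<close> ab(4) asym by blast+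
    ultimately show False
      using ps(2) that by simp
  qed
  have out_b: "\<not> A b y" if "y \<in> C - {u}" for y
  proof
    assume "A b y"
    obtain p s where ps: "A p b" "nbrs c b (c b) = {p, s}"
      using circuit_nbrs[OF assms(1,2) ab(1)] .
    have "u \<in> nbrs c b (c b)" "y \<in> nbrs c b (c b)"
      using that \<open>A b y\<close> ab(1,3) col unfolding nbrs_def adj_def by auto
    moreover have "u \<noteq> p" "y \<noteq> p"
      using ps(1) \<open>A b y\<close> ab(3) asym by blast+
    ultimately show False
      using ps(2) that by simp
  qed
  have u_nbr: "x = b \<or> x = a" if "x \<in> C" "adj u x" for x
  proof -
    have "x \<in> nbrs c u (c u)"
      using that col by (simp add: nbrs_def)
    then show ?thesis
      using N by blast
  qed
  have pred: "\<exists>y\<in>C - {u}. A y x" if x: "x \<in> C - {u} - {a}" for x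
  proof -
    obtain y where "y \<in> C" "A y x"
      using circuit_predecessor[OF circ] x by blast
    then show ?thesis
      using x u_nbr[of x] ab(3) asym unfolding adj_def by blast
  qed
  have succ: "\<exists>y\<in>C - {u}. A x y" if x: "x \<in> C - {u} - {b}" for x
  proof -
    obtain y where "y \<in> C" "A x y"
      using circuit_successor[OF circ] x by blast
    then show ?thesis
      using x u_nbr[of x] ab(4) asym unfolding adj_def by blast
  qed
  have closed: "(c(u := j)) x = c u \<and> nbrs (c(u := j)) x (c u) \<subseteq> C - {u}" if "x \<in> C - {u}" for x
  proof -
    have "y \<in> C - {u}" if "y \<in> nbrs (c(u := j)) x (c u)" for y
      using that circuit_closed[OF assms(1,2), of x y] \<open>x \<in> C - {u}\<close> col[of x] assms(4)
      unfolding nbrs_def by (auto split: if_splits)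
    then show ?thesis
      using that col by auto
  qed
  have "path_between (C - {u}) a b"
    unfolding path_between_def
    by (intro conjI ballI in_a out_b pred succ) (use ab \<open>a \<noteq> u\<close> \<open>b \<noteq> u\<close> in simp_all)
  then have "\<exists>a b. path_between (C - {u}) a b \<and> A b u \<and> A u a"
    using ab(3,4) by blast
  moreover have "\<exists>i. \<forall>x\<in>C - {u}. (c(u := j)) x = i \<and> nbrs (c(u := j)) x i \<subseteq> C - {u}"
    using closed by (intro exI[of _ "c u"] ballI)
  ultimately show ?thesis
    unfolding leftover_def by (rule conjI)
qed

text \<open>
  Only a new neighbour \<open>u\<close> could spoil the isolation of \<open>L\<close> in its colour, but all neighbours
  of \<open>u\<close> in its new colour lie on \<open>C'\<close>.
\<close>

lemma leftover_recolour:
  assumes "leftover c L w" "u \<notin> L" "arc_minimal (c(u := j))"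
    and "C' \<in> mono_circuits (c(u := j))" "u \<in> C'" "C' \<inter> L = {}"
  shows "leftover (c(u := j)) L w"
proof -
  obtain i where i: "\<And>x. x \<in> L \<Longrightarrow> c x = i \<and> nbrs c x i \<subseteq> L"
    using assms(1) unfolding leftover_def by blast
  have "(c(u := j)) x = i \<and> nbrs (c(u := j)) x i \<subseteq> L" if x: "x \<in> L" for x
  proof -
    have "y \<in> L" if y: "y \<in> nbrs (c(u := j)) x i" for y
    proof (cases "y = u")
      case True
      then have "adj u x" "(c(u := j)) x = (c(u := j)) u"
        using y i[OF x] x assms(2) by (auto simp: nbrs_def adj_def)
      then have "x \<in> C'"
        using circuit_closed[OF assms(3-5)] by blast
      then show ?thesis
        using x assms(6) by blast
    next
      case False
      then show ?thesis
        using y i[OF x] by (auto simp: nbrs_def)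
    qed
    then show ?thesis
      using i[OF x] x assms(2) by auto
  qed
  then have "\<exists>i. \<forall>x\<in>L. (c(u := j)) x = i \<and> nbrs (c(u := j)) x i \<subseteq> L"
    by (intro exI[of _ i] ballI)
  then show ?thesis
    using assms(1) unfolding leftover_def by (intro conjI) (rule conjunct1)
qed

text \<open>
  Where the forbidden subgraphs enter. A circuit \<open>C'\<close> through \<open>u\<close> that meets \<open>L\<close> follows the path
  in both directions up to its ends: it cannot stop earlier, since it contains all neighbours of its
  vertices in its colour, and it cannot stay within \<open>L\<close>, since it passes through \<open>u\<close> and is
  minimal. At the ends it can only continue with \<open>u\<close>. So \<open>u\<close> joins the last vertex of the path to
  the first just as \<open>w\<close> does, and the two paths of length two force an arc that the path does not
  have.
\<close>

lemma leftover_not_rejoined: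
  assumes "leftover c L w" "u \<notin> L" "u \<noteq> w" "arc_minimal (c(u := j))"
    and "C' \<in> mono_circuits (c(u := j))" "u \<in> C'"
  shows "C' \<inter> L = {}"
proof (rule ccontr)
  assume meet: "C' \<inter> L \<noteq> {}"
  let ?c = "c(u := j)"
  obtain a b where ab: "a \<in> L" "b \<in> L" "A b w" "A w a"
    and ends: "\<forall>y\<in>L. \<not> A y a \<and> \<not> A b y"
    and pred: "\<forall>x\<in>L - {a}. \<exists>y\<in>L. A y x"
    and succ: "\<forall>x\<in>L - {b}. \<exists>y\<in>L. A x y"
    using assms(1) unfolding leftover_def path_between_def by blast
  obtain i where i: "\<And>x. x \<in> L \<Longrightarrow> c x = i \<and> nbrs c x i \<subseteq> L"
    using assms(1) unfolding leftover_def by blast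
  note circ = mono_circuits_circuit[OF assms(5)] and col = mono_circuits_colour[OF assms(5)]
  have no_fed: "\<not> fed T" if "T \<subseteq> C' \<inter> L" for T
    using that circ assms(2,6) unfolding circuit_def by blast
  \<comment> \<open>Neighbours along the path are neighbours in the same colour, so the circuit contains them too.\<close>
  have stay: "y \<in> C' \<inter> L" if "x \<in> C' \<inter> L" "y \<in> L" "adj x y" for x y
  proof -
    have "x \<noteq> u" "y \<noteq> u"
      using that assms(2) by auto
    then show ?thesis
      using circuit_closed[OF assms(4,5), of x y] that i[of x] i[of y] by auto
  qed
  \<comment> \<open>The path is isolated in its old colour class, so the circuit can leave it only through the
    recoloured vertex.\<close>
  have join: "y = u" if "x \<in> C' \<inter> L" "y \<in> C'" "adj x y" "y \<notin> L" for x y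
  proof (rule ccontr)
    assume "y \<noteq> u"
    moreover have "x \<noteq> u"
      using that assms(2) by auto
    ultimately have "c y = c x"
      using col[of x y] that by auto
    then show False
      using i[of x] that unfolding nbrs_def by auto
  qed
  have a: "a \<in> C'"
  proof (rule ccontr)
    assume a: "a \<notin> C'"
    have "\<exists>y\<in>C' \<inter> L. A y x" if "x \<in> C' \<inter> L" for x
      using pred stay[OF that] that a unfolding adj_def by blast
    then have "fed (C' \<inter> L)"
      using meet unfolding fed_def by blast
    then show False
      using no_fed by blast
  qed
  have b: "b \<in> C'"
  proof (rule ccontr)
    assume b: "b \<notin> C'"
    have "finite (C' \<inter> L)"
      using circuit_subset_V[OF circ] finite_V finite_subset by blast
    moreover have "\<exists>y\<in>C' \<inter> L. A x y" if "x \<in> C' \<inter> L" for x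
      using succ stay[OF that] that b unfolding adj_def by blast
    ultimately show False
      using successor_closed_contains_fed[of "C' \<inter> L"] meet no_fed by blast
  qed
  obtain y where "y \<in> C'" "A y a"
    using circuit_predecessor[OF circ a] by blast
  then have "A u a"
    using join[of a y] a ab(1) ends unfolding adj_def by blast
  obtain z where "z \<in> C'" "A b z"
    using circuit_successor[OF circ b] by blast
  then have "A b u"
    using join[of b z] b ab(2) ends unfolding adj_def by blast
  have "A b a"
    using two_path_closed[OF \<open>A b u\<close> \<open>A u a\<close> ab(3,4) assms(3)] .
  then show False
    using ends ab(2) by blast
qed

text \<open>
  \<open>U\<close> is the union of the leftover paths so far and \<open>v\<close> the vertex moved last, which lies on the
  current circuit \<open>C\<close>; before the first move, \<open>U\<close> is empty and \<open>v\<close> any vertex of \<open>C\<close>. The vertex \<open>w\<close> that left a path \<open>L\<close> behind lies in \<open>U\<close> or is \<open>v\<close> itself, so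
  it differs from the next vertex to be moved. Each move enlarges \<open>U\<close> by the rest of the current
  circuit.
\<close>

lemma no_chain:
  assumes "optimal c" "C \<in> mono_circuits c" "v \<in> C" "U \<subseteq> V" "C \<inter> U = {}"
    and "\<And>x. x \<in> U \<Longrightarrow> \<exists>L w. x \<in> L \<and> L \<subseteq> U \<and> w \<in> insert v U \<and> leftover c L w"
  shows False
  using assms
proof (induction "card (V - U)" arbitrary: c C v U rule: less_induct)
  case less
  have min: "arc_minimal c"
    using less.prems(1) unfolding optimal_def by blast
  note circ = mono_circuits_circuit[OF less.prems(2)]
    and col = mono_circuits_colour[OF less.prems(2)]
  \<comment> \<open>Any vertex of the circuit other than the one moved last would do.\<close>
  obtain u where u: "u \<in> C" "A u v"
    using circuit_predecessor[OF circ less.prems(3)] by blast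
  then have "u \<noteq> v"
    using irrefl by blast
  obtain j where j: "j < K" "j \<noteq> c u" "card (nbrs c u j) = 2"
    using exchange_colour[OF min less.prems(2) u(1)] .
  let ?c = "c(u := j)"
  let ?U = "U \<union> (C - {u})"
  have opt: "optimal ?c"
    using exchange(1)[OF less.prems(1,2) u(1) j(1,3)] .
  then have min': "arc_minimal ?c"
    unfolding optimal_def by blast
  obtain C' where C': "C' \<in> mono_circuits ?c" "u \<in> C'"
    using exchange(2)[OF less.prems(1,2) u(1) j(1,3)] by blast
  have "u \<notin> U"
    using less.prems(5) u(1) by blast
  have disj: "C' \<inter> L = {}" if "L \<subseteq> U" "w \<in> insert v U" "leftover c L w" for L w
    using leftover_not_rejoined[OF that(3) _ _ min' C'] that(1,2) \<open>u \<notin> U\<close> \<open>u \<noteq> v\<close> by blast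
  have "x \<notin> C'" if x: "x \<in> U" for x
  proof -
    obtain L w where L: "x \<in> L" "L \<subseteq> U" "w \<in> insert v U" "leftover c L w"
      using less.prems(6)[OF x] by (elim exE conjE)
    show ?thesis
      using disj[OF L(2-4)] L(1) by blast
  qed
  then have "C' \<inter> U = {}"
    by blast
  moreover have "?c x \<noteq> ?c u" if "x \<in> C - {u}" for x
    using that col[of x u] u(1) j(2) by auto
  then have "C' \<inter> (C - {u}) = {}"
    using mono_circuits_colour[OF C'(1) _ C'(2)] by blast
  ultimately have disj': "C' \<inter> ?U = {}"
    by blast
  have U: "?U \<subseteq> V"
    using less.prems(4) circuit_subset_V[OF circ] by blast
  have "v \<in> V - U"
    using less.prems(3,5) circuit_subset_V[OF circ] by blast
  then have "V - ?U \<subset> V - U"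
    using less.prems(3) \<open>u \<noteq> v\<close> by blast
  then have smaller: "card (V - ?U) < card (V - U)"
    using finite_V by (simp add: psubset_card_mono)
  have "\<exists>L w. x \<in> L \<and> L \<subseteq> ?U \<and> w \<in> insert u ?U \<and> leftover ?c L w" if "x \<in> ?U" for x
  proof (cases "x \<in> U")
    case True
    then obtain L w where L: "x \<in> L" "L \<subseteq> U" "w \<in> insert v U" "leftover c L w"
      using less.prems(6)[OF True] by (elim exE conjE)
    have "leftover ?c L w"
      using leftover_recolour[OF L(4) _ min' C' disj[OF L(2-4)]] L(2) \<open>u \<notin> U\<close>
      by (meson subsetD)
    moreover have "w \<in> insert u ?U"
      using L(3) less.prems(3) by blast
    ultimately show ?thesis
      using L(1,2) by blast
  next
    case False
    then have "x \<in> C - {u}"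
      using that by blast
    then show ?thesis
      using leftover_circuit[OF min less.prems(2) u(1) j(2)]
      by (intro exI[of _ "C - {u}"] exI[of _ u]) simp
  qed
  then show False
    by (rule less.hyps[OF smaller opt C' U disj'])
qed

lemma fed_free_colouring: "\<exists>c. colouring c \<and> (\<forall>T i. fed T \<longrightarrow> (\<exists>x\<in>T. c x \<noteq> i))"
proof -
  obtain c where c: "optimal c"
    using optimal_exists by blast
  have "\<exists>x\<in>T. c x \<noteq> i" if T: "fed T" for T i
  proof (rule ccontr)
    assume mono: "\<not> ?thesis"
    obtain C where "C \<subseteq> T" "circuit C"
      using fed_contains_circuit[OF T] by blast
    moreover from this have "C \<in> mono_circuits c"
      using mono unfolding mono_circuits_def by (simp add: subset_iff)
    moreover obtain v where "v \<in> C"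
      using \<open>circuit C\<close> unfolding circuit_def fed_def by blast
    ultimately show False
      using no_chain[OF c, of C v "{}"] by blast
  qed
  then show ?thesis
    using c unfolding optimal_def arc_minimal_def by blast
qed

end

section \<open>Induced subgraphs, degrees and cycles of digraphs\<close>

context oriented_graph
begin

lemma dominates_asym:
  assumes "x \<rightarrow>\<^bsub>G\<^esub> y"
  shows "\<not> y \<rightarrow>\<^bsub>G\<^esub> x"
proof
  assume "y \<rightarrow>\<^bsub>G\<^esub> x"
  then obtain e1 e2 where e: "e1 \<in> arcs G" "tail G e1 = x" "head G e1 = y"
    "e2 \<in> arcs G" "tail G e2 = y" "head G e2 = x"
    using assms by (auto simp: arcs_ends_conv)
  then have "e1 = e2"
    by (intro at_most_one_arc) auto
  then show False
    using e no_loops by metis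
qed

sublocale finite_orientation "verts G" "\<lambda>x y. x \<rightarrow>\<^bsub>G\<^esub> y"
  by unfold_locales (use dominates_asym adj_in_verts in auto)

lemma card_adj_le_max_degree:
  assumes "u \<in> verts G"
  shows "card {y. adj u y} \<le> max_degree G"
proof -
  have "{y. adj u y} = tail G ` in_arcs G u \<union> head G ` out_arcs G u"
    unfolding adj_def by (auto simp: arcs_ends_conv in_arcs_def out_arcs_def)
  then have "card {y. adj u y} \<le> card (tail G ` in_arcs G u) + card (head G ` out_arcs G u)"
    using card_Un_le by metis
  also have "\<dots> \<le> in_degree G u + out_degree G u"
    unfolding in_degree_def out_degree_def by (intro add_mono card_image_le) auto
  also have "\<dots> \<le> max_degree G"
    unfolding max_degree_def using assms by (intro Max_ge) auto
  finally show ?thesis .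
qed

text \<open>
  Without parallel arcs an arc is determined by its ends, so a bijection of the vertices that respects
  adjacency extends to an isomorphism of digraphs.
\<close>

lemma contains_inducedI:
  assumes "inj_on f S" "S \<subseteq> verts G" "f ` S = pverts F"
    and "parcs F \<subseteq> pverts F \<times> pverts F"
    and "\<And>x y. x \<in> S \<Longrightarrow> y \<in> S \<Longrightarrow> x \<rightarrow>\<^bsub>G\<^esub> y \<longleftrightarrow> (f x, f y) \<in> parcs F"
  shows "contains_induced G (with_proj F)"
proof -
  let ?H = "G \<restriction> S"
  let ?f = "\<lparr>iso_verts = f, iso_arcs = \<lambda>e. (f (tail G e), f (head G e)), iso_head = snd, iso_tail = fst\<rparr>"
  have inj: "inj_on (iso_arcs ?f) (arcs ?H)"
  proof (rule inj_onI)
    fix e1 e2 assume e: "e1 \<in> arcs ?H" "e2 \<in> arcs ?H" "iso_arcs ?f e1 = iso_arcs ?f e2"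
    then have "tail G e1 = tail G e2" "head G e1 = head G e2"
      using inj_onD[OF assms(1)] by auto
    then show "e1 = e2"
      using e no_multi_arcs[of e1 e2] by (simp add: arc_to_ends_def)
  qed
  have "iso_arcs ?f ` arcs ?H = parcs F"
  proof (intro equalityI subsetI)
    fix e assume "e \<in> iso_arcs ?f ` arcs ?H"
    then obtain e' where e': "e' \<in> arcs G" "tail G e' \<in> S" "head G e' \<in> S"
      "e = (f (tail G e'), f (head G e'))"
      by auto
    then have "tail G e' \<rightarrow>\<^bsub>G\<^esub> head G e'"
      by (auto simp: arcs_ends_conv)
    then show "e \<in> parcs F"
      using assms(5) e' by blast
  next
    fix e assume e: "e \<in> parcs F"
    then have "e \<in> f ` S \<times> f ` S"
      using assms(3,4) by auto
    then obtain x y where xy: "e = (f x, f y)" "x \<in> S" "y \<in> S"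
      by blast
    then have "x \<rightarrow>\<^bsub>G\<^esub> y"
      using assms(5) e by blast
    then show "e \<in> iso_arcs ?f ` arcs ?H"
      using xy by (force simp: arcs_ends_conv)
  qed
  then have "with_proj F = app_iso ?f ?H"
    using assms(3) by (simp add: with_proj_def app_iso_def)
  moreover have "pre_digraph.digraph_isomorphism ?H ?f"
    unfolding pre_digraph.digraph_isomorphism_def using inj assms(1) by auto
  moreover have "induced_subgraph ?H G"
    using assms(2) by (rule induced_induce)
  ultimately show ?thesis
    unfolding contains_induced_def digraph_iso_def by blast
qed

text \<open>
  Each of the four forbidden digraphs is one combination of the adjacencies that the two paths leave
  open. The digraphs \<open>F2\<close> and \<open>G2\<close> have the arc from \<open>W\<close> to \<open>R\<close>, so in case of an arc from \<open>r\<close> to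
  \<open>w\<close> the two inner vertices exchange their roles.
\<close>

lemma arc_between_ends_of_two_paths:
  assumes free: "\<not> contains_induced G (with_proj F1)" "\<not> contains_induced G (with_proj F2)"
    "\<not> contains_induced G (with_proj G1)" "\<not> contains_induced G (with_proj G2)"
    and arcs: "q \<rightarrow>\<^bsub>G\<^esub> r" "r \<rightarrow>\<^bsub>G\<^esub> y" "q \<rightarrow>\<^bsub>G\<^esub> w" "w \<rightarrow>\<^bsub>G\<^esub> y" "r \<noteq> w"
  shows "q \<rightarrow>\<^bsub>G\<^esub> y"
proof (rule ccontr)
  assume qy: "\<not> q \<rightarrow>\<^bsub>G\<^esub> y"
  have False if rw: "\<not> r \<rightarrow>\<^bsub>G\<^esub> w"
    and arcs: "q \<rightarrow>\<^bsub>G\<^esub> r" "r \<rightarrow>\<^bsub>G\<^esub> y" "q \<rightarrow>\<^bsub>G\<^esub> w" "w \<rightarrow>\<^bsub>G\<^esub> y" "r \<noteq> w" for r w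
  proof -
    have ne: "q \<noteq> r" "q \<noteq> w" "q \<noteq> y" "r \<noteq> y" "w \<noteq> y"
      using arcs irrefl dominates_asym by blast+
    define f where "f = (\<lambda>_. Y)(q := Q, r := R, w := W)"
    let ?S = "{q, r, w, y}"
    have f: "f q = Q" "f r = R" "f w = W" "f y = Y"
      unfolding f_def using ne arcs(5) by auto
    have inj: "inj_on f ?S"
      using f by (simp add: inj_on_def)
    have sub: "?S \<subseteq> verts G"
      using arcs by (simp add: adj_in_verts)
    have non: "\<not> r \<rightarrow>\<^bsub>G\<^esub> q" "\<not> y \<rightarrow>\<^bsub>G\<^esub> r" "\<not> w \<rightarrow>\<^bsub>G\<^esub> q" "\<not> y \<rightarrow>\<^bsub>G\<^esub> w" "\<not> x \<rightarrow>\<^bsub>G\<^esub> x" for x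
      using arcs irrefl dominates_asym by blast+
    define F where "F = (if y \<rightarrow>\<^bsub>G\<^esub> q then if w \<rightarrow>\<^bsub>G\<^esub> r then G2 else G1
      else if w \<rightarrow>\<^bsub>G\<^esub> r then F2 else F1)"
    have pverts: "pverts F = {Q, R, W, Y}"
      by (simp add: F_def F1_def F2_def G1_def G2_def)
    have parcs: "(Q,R) \<in> parcs F" "(Q,W) \<in> parcs F" "(R,Y) \<in> parcs F" "(W,Y) \<in> parcs F"
      "(W,R) \<in> parcs F \<longleftrightarrow> w \<rightarrow>\<^bsub>G\<^esub> r" "(Y,Q) \<in> parcs F \<longleftrightarrow> y \<rightarrow>\<^bsub>G\<^esub> q"
      "(Q,Y) \<notin> parcs F" "(R,Q) \<notin> parcs F" "(W,Q) \<notin> parcs F" "(Y,R) \<notin> parcs F"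
      "(Y,W) \<notin> parcs F" "(R,W) \<notin> parcs F" "(z,z) \<notin> parcs F" for z
      by (auto simp: F_def F1_def F2_def G1_def G2_def)
    have "contains_induced G (with_proj F)"
    proof (rule contains_inducedI[OF inj sub])
      show "parcs F \<subseteq> pverts F \<times> pverts F"
        by (auto simp: F_def F1_def F2_def G1_def G2_def)
      show "a \<rightarrow>\<^bsub>G\<^esub> b \<longleftrightarrow> (f a, f b) \<in> parcs F" if "a \<in> ?S" "b \<in> ?S" for a b
        using that by (elim insertE emptyE) (simp_all add: f parcs arcs non rw qy)
    qed (simp add: f pverts)
    then show False
      using free unfolding F_def by (simp split: if_splits)
  qed
  from this[of r w] this[of w r] show False
    using arcs dominates_asym[of r w] by blast
qed

text \<open>
  On a closed walk the tail of each arc is the head of some arc of the walk.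
\<close>

lemma not_acyclic_imp_fed:
  assumes "S \<subseteq> verts G" "\<not> acyclic_set G S"
  shows "\<exists>T\<subseteq>S. fed T"
proof -
  interpret S: wf_digraph "G \<restriction> S"
    by (rule wellformed_induce_subgraph)
  obtain u p where p: "S.awalk u p u" "p \<noteq> []"
    using assms unfolding acyclic_set_def S.cycle_def by blast
  have tails: "tail G ` set p \<subseteq> insert u (head G ` set p) \<and> v \<in> head G ` set p"
    if "S.cas u p v" "p \<noteq> []" for u v p
    using that
  proof (induction p arbitrary: u)
    case (Cons e p)
    then show ?case
      by (cases "p = []") auto
  qed simp
  have sub: "set p \<subseteq> arcs (G \<restriction> S)" and cas: "S.cas u p u"
    using p(1) unfolding S.awalk_def by blast+
  let ?T = "head G ` set p"
  have "\<exists>y\<in>?T. y \<rightarrow>\<^bsub>G\<^esub> x" if x: "x \<in> ?T" for x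
  proof -
    obtain e where e: "e \<in> set p" "x = head G e"
      using x by blast
    then have "tail G e \<in> ?T"
      using tails[OF cas p(2)] by blast
    moreover have "tail G e \<rightarrow>\<^bsub>G\<^esub> x"
      using e sub by (auto simp: arcs_ends_conv)
    ultimately show ?thesis ..
  qed
  then have "fed ?T"
    using p(2) unfolding fed_def by auto
  moreover have "?T \<subseteq> S"
    using sub by auto
  ultimately show ?thesis
    by blast
qed

lemma dichromatic_number_le:
  assumes range: "\<And>v. v \<in> verts G \<Longrightarrow> c v < K"
    and classes: "\<And>i. acyclic_set G {v \<in> verts G. c v = i}"
  shows "dichromatic_number G \<le> K"
proof -
  \<comment> \<open>Only the colours that occur, since the parts of a partition are nonempty.\<close>
  let ?P = "(\<lambda>i. {v \<in> verts G. c v = i}) ` c ` verts G"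
  have "partition_on (verts G) ?P"
    by (rule partition_onI) (auto simp: disjnt_def)
  moreover have "finite ?P" "\<forall>S\<in>?P. acyclic_set G S"
    using classes by auto
  ultimately have "dichromatic_number G \<le> card ?P"
    unfolding dichromatic_number_def by (intro Least_le) blast
  also have "\<dots> \<le> card (c ` verts G)"
    by (intro card_image_le) simp
  also have "\<dots> \<le> card {..<K}"
    using range by (intro card_mono) auto
  finally show ?thesis
    by simp
qed

end

theorem theorem3p2:
  fixes D :: "('a, 'b) pre_digraph"
  assumes "oriented_graph D"
    and "\<not> contains_induced D (with_proj F1)"
    and "\<not> contains_induced D (with_proj F2)"
    and "\<not> contains_induced D (with_proj G1)"
    and "\<not> contains_induced D (with_proj G2)"
  shows "int (dichromatic_number D) \<le> \<lfloor>1 / 3 * real (max_degree D) + 5 / 3\<rfloor>"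
proof -
  interpret oriented_graph D
    by fact
  \<comment> \<open>The floor in the conclusion, as a quotient of natural numbers.\<close>
  let ?K = "(max_degree D + 5) div 3"
  interpret sparse_orientation "verts D" "\<lambda>x y. x \<rightarrow>\<^bsub>D\<^esub> y" ?K
  proof unfold_locales
    fix u assume "u \<in> verts D"
    then show "card {y. adj u y} + 2 \<le> 3 * ?K"
      using card_adj_le_max_degree[of u] by linarith
  qed (use arc_between_ends_of_two_paths[OF assms(2-5)] in blast)
  obtain c where c: "colouring c" "\<And>T i. fed T \<Longrightarrow> \<exists>x\<in>T. c x \<noteq> i"
    using fed_free_colouring by blast
  have "acyclic_set D {v \<in> verts D. c v = i}" for i
    using not_acyclic_imp_fed[of "{v \<in> verts D. c v = i}"] c(2)[of _ i] by blast
  then have "dichromatic_number D \<le> ?K"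
    using dichromatic_number_le c(1) unfolding colouring_def by blast
  then have "int (dichromatic_number D) \<le> \<lfloor>real (max_degree D + 5) / real 3\<rfloor>"
    unfolding floor_divide_of_nat_eq by simp
  then show ?thesis
    by (simp add: add_divide_distrib)
qed

end
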